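(* For every integer $n\ge 0$, the Tutte polynomial of the matroid $\mathcal M_n$ is $$T_{\mathcal M_n}(x,y)=\prod_{k=1}^n\bigl(x-1+(k)_y\bigr),$$ where $(k)_y=\frac{y^k-1}{y-1}$.
   Context: $[n]$ denotes the linearly ordered set $\{0<1<\dots<n\}$, with meet $i\wedge j=\min(i,j)$. $[n]^\to$ denotes the set of nontrivial edges of $[n]$, i.e. pairs $(i\to j)$ with $0\le i<j\le n$. A transfer system on $[n]$ is a partial order $T$ on the set $[n]$ that is contained in $\le$ (reflexive, transitive, and $i\,T\,j$ implies $i\le j$) and is closed under restriction: if $i\,T\,j$ and $k\in[n]$, then $(i\wedge k)\,T\,(j\wedge k)$. For every $S\subseteq[n]^\to$ there is a smallest transfer system containing $S$, called the transfer system generated by $S$. A set $S\subseteq [n]^\to$ is a minimal generating set if no proper subset of $S$ generates the same transfer system as $S$; $\mathrm{MGS}([n])\subseteq\mathcal P([n]^\to)$ denotes the collection of all minimal generating sets (of all transfer systems on $[n]$). $\mathcal M_n=([n]^\to,\mathrm{MGS}([n]))$ is the matroid with ground set $[n]^\to$ whose independent sets are the elements of $\mathrm{MGS}([n])$ (it is a fact that this pair is a matroid). For a matroid $(E,I)$ with ground set $E$ and collection of independent sets $I$, the rank $r(S)$ of $S\subseteq E$ is the size of a largest independent subset of $S$, and the Tutte polynomial is $$T_E(x,y)=\sum_{S\subseteq E}(x-1)^{r(E)-r(S)}(y-1)^{|S|-r(S)}.$$ The expression $(k)_y=\frac{y^k-1}{y-1}$ is the polynomial $1+y+\dots+y^{k-1}$.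 *)

theory Defs
  imports "HOL-Computational_Algebra.Polynomial"
begin

section \<open>Transfer systems on \<open>[n] = {0 < 1 < \<dots> < n}\<close>\<close>

definition edges :: "nat \<Rightarrow> (nat \<times> nat) set" where
  "edges n = {(i, j). i < j \<and> j \<le> n}"

definition transfer_system :: "nat \<Rightarrow> (nat \<times> nat) set \<Rightarrow> bool" where
  "transfer_system n T \<longleftrightarrow>
     partial_order_on {0..n} T \<and>
     (\<forall>(i, j)\<in>T. i \<le> j) \<and>
     (\<forall>(i, j)\<in>T. \<forall>k\<in>{0..n}. (min i k, min j k) \<in> T)"

definition generated :: "nat \<Rightarrow> (nat \<times> nat) set \<Rightarrow> (nat \<times> nat) set" where
  "generated n S = \<Inter>{T. transfer_system n T \<and> S \<subseteq> T}"

text \<open>For \<open>S \<subseteq> edges n\<close> the intersected family contains the relation \<open>\<le>\<close> on \<open>{0..n}\<close>, so it is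
  nonempty and \<^term>\<open>generated n S\<close> is indeed the smallest transfer system containing \<open>S\<close>.\<close>

lemma transfer_system_le: "transfer_system n {(i, j). i \<le> j \<and> j \<le> n}"
proof -
  have "trans {(i, j). i \<le> j \<and> j \<le> n}"
    by (rule transI) auto
  moreover have "antisym {(i, j). i \<le> j \<and> j \<le> n}"
    by (rule antisymI) auto
  ultimately show ?thesis
    by (auto simp: transfer_system_def partial_order_on_def preorder_on_def refl_on_def)
qed

lemma generated_least:
  assumes "S \<subseteq> edges n"
  shows "transfer_system n (generated n S)"
    and "S \<subseteq> generated n S"
    and "\<And>T. transfer_system n T \<Longrightarrow> S \<subseteq> T \<Longrightarrow> generated n S \<subseteq> T"
proof -
  have "S \<subseteq> {(i, j). i \<le> j \<and> j \<le> n}"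
    using assms by (auto simp: edges_def)
  with transfer_system_le have sub: "generated n S \<subseteq> {(i, j). i \<le> j \<and> j \<le> n}"
    unfolding generated_def by blast
  have ts: "trans T" "refl_on {0..n} T"
    "(i, j) \<in> T \<Longrightarrow> k \<in> {0..n} \<Longrightarrow> (min i k, min j k) \<in> T"
    if "transfer_system n T" for T i j k
    using that unfolding transfer_system_def partial_order_on_def preorder_on_def by blast+
  have "generated n S \<subseteq> {0..n} \<times> {0..n}"
    using sub by force
  moreover have "trans (generated n S)"
    unfolding generated_def using ts(1) by (intro transI InterI) (blast dest: transD)
  moreover have "refl_on {0..n} (generated n S)"
    unfolding generated_def using ts(2) by (auto simp: refl_on_def)
  moreover have "antisym (generated n S)"
  proof (rule antisymI)
    fix i j assume "(i, j) \<in> generated n S" "(j, i) \<in> generated n S"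
    with sub have "i \<le> j" "j \<le> i" by blast+
    then show "i = j" by simp
  qed
  moreover have "\<forall>(i, j)\<in>generated n S. i \<le> j"
    using sub by blast
  moreover have "\<forall>(i, j)\<in>generated n S. \<forall>k\<in>{0..n}. (min i k, min j k) \<in> generated n S"
    unfolding generated_def using ts(3) by blast
  ultimately show "transfer_system n (generated n S)"
    unfolding transfer_system_def partial_order_on_def preorder_on_def by blast
  show "S \<subseteq> generated n S"
    unfolding generated_def by blast
  show "\<And>T. transfer_system n T \<Longrightarrow> S \<subseteq> T \<Longrightarrow> generated n S \<subseteq> T"
    unfolding generated_def by blast
qed

definition MGS :: "nat \<Rightarrow> (nat \<times> nat) set set" where
  "MGS n = {S. S \<subseteq> edges n \<and> (\<forall>S'. S' \<subset> S \<longrightarrow> generated n S' \<noteq> generated n S)}"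

section \<open>Rank and Tutte polynomial\<close>

text \<open>A matroid is given as a pair \<open>(E, I)\<close> of its finite ground set and its collection of independent
  sets; \<open>rank\<close> and \<open>tutte_poly\<close> make sense for any such pair with \<open>{} \<in> I\<close>.\<close>

definition rank :: "'a set set \<Rightarrow> 'a set \<Rightarrow> nat" where
  "rank I S = Max {card A |A. A \<in> I \<and> A \<subseteq> S}"

text \<open>The ring \<open>\<int>[x, y]\<close> is represented as \<open>\<int>[y][x]\<close>.\<close>

definition varX :: "int poly poly" where
  "varX = [:0, 1:]"

definition varY :: "int poly poly" where
  "varY = [:[:0, 1:]:]"

text \<open>The natural-number subtractions in the exponents do not truncate, since
  \<open>rank I S \<le> rank I E\<close> and \<open>rank I S \<le> card S\<close>.\<close>

fun tutte_poly :: "'a set \<times> 'a set set \<Rightarrow> int poly poly" where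
  "tutte_poly (E, I) =
     (\<Sum>S\<in>Pow E. (varX - 1) ^ (rank I E - rank I S) * (varY - 1) ^ (card S - rank I S))"

definition q_int :: "nat \<Rightarrow> int poly poly" where
  "q_int k = (\<Sum>i<k. varY ^ i)"

text \<open>Hence \<open>q_int k\<close> is the quotient \<open>(varY ^ k - 1) / (varY - 1)\<close> in the integral domain \<open>\<int>[x, y]\<close>.\<close>

lemma q_int_mult: "(varY - 1) * q_int k = varY ^ k - 1"
  by (simp add: q_int_def power_diff_1_eq)

definition transfer_matroid :: "nat \<Rightarrow> (nat \<times> nat) set \<times> (nat \<times> nat) set set" where
  "transfer_matroid n = (edges n, MGS n)"

end

theory Submission
  imports Defs
begin

text \<open>
  Restricting a nontrivial edge yields a trivial edge or one with the same source, and a chain of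
  edges composes to an edge with the source of its first nontrivial member. So an edge with source
  \<open>i\<close> can only be generated in the presence of an edge with source \<open>i\<close>, while of two edges with a
  common source the longer one generates the shorter one. Hence a set of edges is independent iff
  no two of its edges share a source: the matroid is the direct sum of the uniform matroids
  \<open>U\<^bsub>1,k\<^esub>\<close> for \<open>1 \<le> k \<le> n\<close>, where \<open>k = n - i\<close> is the number of edges with source \<open>i\<close>.
\<close>

text \<open>This is the largest transfer system with no nontrivial edge out of \<open>i\<close>. It
  bounds from above whatever edges with other sources generate.\<close>

lemma transfer_system_no_source:
  "transfer_system n {(a, b). a \<le> b \<and> b \<le> n \<and> (a = i \<longrightarrow> b = i)}" (is "transfer_system n ?T")
proof -
  have "refl_on {0..n} ?T"
    by (auto simp: refl_on_def)
  moreover have "trans ?T"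
    by (rule transI) auto
  moreover have "antisym ?T"
    by (rule antisymI) auto
  moreover have "?T \<subseteq> {0..n} \<times> {0..n}"
    by auto
  moreover have "\<forall>(a, b)\<in>?T. \<forall>k\<in>{0..n}. (min a k, min b k) \<in> ?T"
    by (auto simp: min_def)
  ultimately show ?thesis
    unfolding transfer_system_def partial_order_on_def preorder_on_def by blast
qed

lemma generated_no_source:
  assumes "S \<subseteq> edges n" and "i \<notin> fst ` S" and "i < j"
  shows "(i, j) \<notin> generated n S"
proof -
  have "S \<subseteq> {(a, b). a \<le> b \<and> b \<le> n \<and> (a = i \<longrightarrow> b = i)}"
    using assms(1,2) by (force simp: edges_def)
  then have "generated n S \<subseteq> {(a, b). a \<le> b \<and> b \<le> n \<and> (a = i \<longrightarrow> b = i)}"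
    by (rule generated_least(3)[OF assms(1) transfer_system_no_source])
  with \<open>i < j\<close> show ?thesis
    by blast
qed

text \<open>Restricting \<open>(i, k)\<close> along \<open>j\<close> gives \<open>(i, j)\<close>,
  because \<open>i < j < k\<close>.\<close>

lemma generated_remove_shorter:
  assumes S: "S \<subseteq> edges n" and jk: "j < k" and ij: "(i, j) \<in> S" and ik: "(i, k) \<in> S"
  shows "generated n (S - {(i, j)}) = generated n S"
proof (rule antisym)
  let ?S = "S - {(i, j)}"
  have S': "?S \<subseteq> edges n"
    using S by blast
  note ts = generated_least(1)[OF S'] and sub = generated_least(2)[OF S']
  show "generated n ?S \<subseteq> generated n S"
    by (rule generated_least(3)[OF S' generated_least(1)[OF S]])
      (use generated_least(2)[OF S] in blast)
  have "(i, k) \<in> generated n ?S"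
    using sub ik jk by blast
  moreover have "i < j" "j \<in> {0..n}"
    using S ij by (auto simp: edges_def)
  ultimately have "(min i j, min k j) \<in> generated n ?S"
    using ts unfolding transfer_system_def by blast
  with \<open>i < j\<close> jk have "(i, j) \<in> generated n ?S"
    by (simp add: min_def)
  with sub have "S \<subseteq> generated n ?S"
    by blast
  then show "generated n S \<subseteq> generated n ?S"
    by (rule generated_least(3)[OF S ts])
qed

lemma MGS_eq: "MGS n = {S. S \<subseteq> edges n \<and> inj_on fst S}"
proof (intro set_eqI iffI)
  fix S
  assume "S \<in> MGS n"
  then have S: "S \<subseteq> edges n" and min: "\<And>S'. S' \<subset> S \<Longrightarrow> generated n S' \<noteq> generated n S"
    by (auto simp: MGS_def)
  have no_shorter: "\<not> j < k" if "(i, j) \<in> S" "(i, k) \<in> S" for i j k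
  proof
    assume "j < k"
    with S that have "generated n (S - {(i, j)}) = generated n S"
      by (intro generated_remove_shorter)
    with min that show False
      by blast
  qed
  have "inj_on fst S"
  proof (rule inj_onI)
    fix e f
    assume "e \<in> S" "f \<in> S" "fst e = fst f"
    then show "e = f"
      using no_shorter by (metis linorder_neqE_nat prod.collapse)
  qed
  with S show "S \<in> {S. S \<subseteq> edges n \<and> inj_on fst S}"
    by blast
next
  fix S
  assume "S \<in> {S. S \<subseteq> edges n \<and> inj_on fst S}"
  then have S: "S \<subseteq> edges n" and inj: "inj_on fst S"
    by auto
  have "generated n S' \<noteq> generated n S" if sub: "S' \<subset> S" for S'
  proof -
    obtain i j where ij: "(i, j) \<in> S" "(i, j) \<notin> S'"
      using sub by auto
    \<comment> \<open>By injectivity \<open>(i, j)\<close> is the only edge of \<open>S\<close> with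
      source \<open>i\<close>, so removing it removes the source.\<close>
    then have "i \<notin> fst ` S'"
      using ij sub inj unfolding inj_on_def by fastforce
    moreover have "i < j"
      using S ij by (auto simp: edges_def)
    ultimately have "(i, j) \<notin> generated n S'"
      using sub S by (intro generated_no_source) auto
    with generated_least(2)[OF S] ij show ?thesis
      by blast
  qed
  with S show "S \<in> MGS n"
    by (auto simp: MGS_def)
qed

text \<open>The independent sets are the partial transversals of the fibres of \<open>f\<close>, so
  the rank counts the fibres that \<open>S\<close> meets.\<close>

lemma rank_inj_on:
  assumes "finite E" and "S \<subseteq> E"
  shows "rank {A. A \<subseteq> E \<and> inj_on f A} S = card (f ` S)"
  unfolding rank_def
proof (rule Max_eqI)
  have fin: "finite S"
    using assms finite_subset by blast
  then have le: "card A \<le> card (f ` S)" if "inj_on f A" "A \<subseteq> S" for A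
    using that by (metis card_image card_mono finite_imageI image_mono)
  have "{card A |A. A \<in> {A. A \<subseteq> E \<and> inj_on f A} \<and> A \<subseteq> S} \<subseteq> {..card (f ` S)}"
    using le by auto
  then show "finite {card A |A. A \<in> {A. A \<subseteq> E \<and> inj_on f A} \<and> A \<subseteq> S}"
    by (rule finite_subset) simp
  show "y \<le> card (f ` S)" if "y \<in> {card A |A. A \<in> {A. A \<subseteq> E \<and> inj_on f A} \<and> A \<subseteq> S}" for y
    using that le by auto
  \<comment> \<open>The bound is attained by choosing one element of \<open>S\<close> over each
    value of \<open>f\<close>.\<close>
  obtain A where "A \<subseteq> S" "inj_on f A" "f ` S = f ` A"
    using subset_image_inj[of "f ` S" f S] by auto
  then show "card (f ` S) \<in> {card A |A. A \<in> {A. A \<subseteq> E \<and> inj_on f A} \<and> A \<subseteq> S}"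
    using assms(2) by (auto simp: card_image intro!: exI[of _ A])
qed

lemma sum_Pow_insert:
  assumes "finite B" and "b \<notin> B"
  shows "sum g (Pow (insert b B)) = sum g (Pow B) + (\<Sum>T\<in>Pow B. g (insert b T))"
proof -
  have "inj_on (insert b) (Pow B)"
    using assms(2) by (auto simp: inj_on_def)
  moreover have "Pow B \<inter> insert b ` Pow B = {}"
    using assms(2) by auto
  ultimately show ?thesis
    using assms(1) by (simp add: Pow_insert sum.union_disjoint sum.reindex)
qed

text \<open>Expand the product: each element of \<open>B\<close> contributes 1 if left out and
  \<open>v\<close> if chosen.\<close>

lemma sum_Pow_power_card:
  fixes v :: "'b::comm_ring_1"
  assumes "finite B"
  shows "(\<Sum>T\<in>Pow B. v ^ card T) = (1 + v) ^ card B"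
  using assms
proof induction
  case (insert b B)
  have "(\<Sum>T\<in>Pow B. v ^ card (insert b T)) = (\<Sum>T\<in>Pow B. v * v ^ card T)"
    using insert.hyps by (intro sum.cong refl) (auto simp: card_insert_if finite_subset)
  with insert show ?case
    by (simp add: sum_Pow_insert algebra_simps flip: sum_distrib_left)
qed simp

text \<open>After multiplication by \<open>v\<close> this is the geometric sum formula for
  \<open>(1 + v) ^ card B - 1\<close>. Induction avoids dividing by \<open>v\<close>, which may be a
  zero divisor.\<close>

lemma sum_nonempty_subsets_power_card:
  fixes v :: "'b::comm_ring_1"
  assumes "finite B"
  shows "(\<Sum>T\<in>Pow B - {{}}. v ^ (card T - 1)) = (\<Sum>i<card B. (1 + v) ^ i)"
  using assms
proof induction
  case (insert b B)
  \<comment> \<open>The subsets containing \<open>b\<close> supply the new top term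
    \<open>(1 + v) ^ card B\<close> of the geometric sum.\<close>
  have "(\<Sum>T\<in>Pow B. v ^ (card (insert b T) - 1)) = (\<Sum>T\<in>Pow B. v ^ card T)"
    using insert.hyps by (intro sum.cong refl) (auto simp: card_insert_if finite_subset)
  with insert show ?case
    by (simp add: sum_diff1 sum_Pow_insert sum_Pow_power_card)
qed simp

text \<open>A subset of the union is determined by its traces on \<open>A\<close> and
  \<open>B\<close>. This lets sums over subsets factor along a direct sum.\<close>

lemma sum_Pow_Un_disjoint:
  assumes "A \<inter> B = {}"
  shows "sum g (Pow (A \<union> B)) = (\<Sum>S\<in>Pow A. \<Sum>T\<in>Pow B. g (S \<union> T))"
proof -
  have "bij_betw (\<lambda>(S, T). S \<union> T) (Pow A \<times> Pow B) (Pow (A \<union> B))"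
    by (rule bij_betw_byWitness[where f' = "\<lambda>S. (S \<inter> A, S \<inter> B)"]) (use assms in auto)
  then show ?thesis
    by (simp add: sum.cartesian_product sum.reindex_bij_betw[symmetric] case_prod_unfold)
qed

text \<open>The exponents are the corank and the nullity of \<open>S\<close> in a direct sum of rank-one uniform
  matroids on the sets \<open>B a\<close>.\<close>

lemma sum_Pow_Sigma_corank_nullity:
  fixes u v :: "'c::comm_ring_1"
  assumes "finite A" and "\<And>a. a \<in> A \<Longrightarrow> finite (B a)"
  shows "(\<Sum>S\<in>Pow (Sigma A B). u ^ (card A - card (fst ` S)) * v ^ (card S - card (fst ` S))) =
    (\<Prod>a\<in>A. u + (\<Sum>i<card (B a). (1 + v) ^ i))"
  using assms
proof induction
  case (insert a A)
  let ?g = "\<lambda>A S. u ^ (card A - card (fst ` S)) * v ^ (card S - card (fst ` S))"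
  let ?R = "Sigma A B"
  \<comment> \<open>The factor of the block over \<open>a\<close>: an empty trace adds one to the
    corank, while a nonempty trace \<open>T\<close> has rank one and hence nullity
    \<open>card T - 1\<close>.\<close>
  let ?h = "\<lambda>T. if T = {} then u else v ^ (card T - 1)"
  have finR: "finite ?R" and finB: "finite (B a)"
    using insert by auto
  have step: "?g (insert a A) (Pair a ` T \<union> S) = ?h T * ?g A S" if "T \<subseteq> B a" "S \<subseteq> ?R" for T S
  proof -
    have fin: "finite S" "finite T"
      using that finR finB finite_subset by blast+
    have a: "a \<notin> fst ` S" and sub: "fst ` S \<subseteq> A"
      using that insert.hyps by auto
    have leA: "card (fst ` S) \<le> card A" and leS: "card (fst ` S) \<le> card S"
      using sub fin insert.hyps by (auto intro: card_mono card_image_le)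
    show ?thesis
    proof (cases "T = {}")
      case True
      then show ?thesis
        using leA insert.hyps by (simp add: Suc_diff_le)
    next
      case False
      have "fst ` (Pair a ` T \<union> S) = insert a (fst ` S)"
        using False by force
      then have img: "card (fst ` (Pair a ` T \<union> S)) = Suc (card (fst ` S))"
        using a fin by simp
      have "card (Pair a ` T \<union> S) = card (Pair a ` T) + card S"
        using a fin by (intro card_Un_disjoint) force+
      then have card: "card (Pair a ` T \<union> S) = card T + card S"
        by (simp add: card_image inj_on_def)
      have "card T > 0"
        using False fin by (simp add: card_gt_0_iff)
      \<comment> \<open>Neither difference on the right truncates, so the nullities of the two
        traces add up.\<close>
      then have "card T + card S - Suc (card (fst ` S)) = (card T - 1) + (card S - card (fst ` S))"
        using leS by simp
      then show ?thesis
        using False insert.hyps by (simp only: img card) (simp add: power_add)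
    qed
  qed
  have "Pow (Pair a ` B a) = (`) (Pair a) ` Pow (B a)"
    by (simp add: image_Pow_surj)
  moreover have "inj_on ((`) (Pair a)) (Pow (B a))"
    by (rule inj_on_image_Pow) (simp add: inj_on_def)
  ultimately have reindex: "sum G (Pow (Pair a ` B a)) = (\<Sum>T\<in>Pow (B a). G (Pair a ` T))"
    for G :: "_ \<Rightarrow> 'c"
    by (simp add: sum.reindex)
  have "Sigma (insert a A) B = Pair a ` B a \<union> ?R" "Pair a ` B a \<inter> ?R = {}"
    using insert.hyps by auto
  then have "sum (?g (insert a A)) (Pow (Sigma (insert a A) B)) =
      (\<Sum>T\<in>Pow (B a). \<Sum>S\<in>Pow ?R. ?g (insert a A) (Pair a ` T \<union> S))"
    by (simp only: sum_Pow_Un_disjoint reindex)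
  also have "\<dots> = (\<Sum>T\<in>Pow (B a). \<Sum>S\<in>Pow ?R. ?h T * ?g A S)"
    by (intro sum.cong refl step) auto
  also have "\<dots> = sum ?h (Pow (B a)) * sum (?g A) (Pow ?R)"
    by (simp only: sum_product)
  also have "sum ?h (Pow (B a)) = u + sum ?h (Pow (B a) - {{}})"
    using finB by (subst sum.remove[of _ "{}"]) auto
  also have "sum ?h (Pow (B a) - {{}}) = (\<Sum>T\<in>Pow (B a) - {{}}. v ^ (card T - 1))"
    by (intro sum.cong) auto
  also have "\<dots> = (\<Sum>i<card (B a). (1 + v) ^ i)"
    by (rule sum_nonempty_subsets_power_card[OF finB])
  also have "sum (?g A) (Pow ?R) = (\<Prod>a\<in>A. u + (\<Sum>i<card (B a). (1 + v) ^ i))"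
    using insert by blast
  finally show ?case
    using insert.hyps by simp
qed simp

lemma edges_eq_Sigma: "edges n = (SIGMA i:{..<n}. {i<..n})"
  by (auto simp: edges_def)

text \<open>Each \<open>i < n\<close> is the source of \<open>(i, n)\<close>, so the whole matroid
  has rank \<open>n\<close>.\<close>

lemma fst_edges: "fst ` edges n = {..<n}"
  by (auto simp: edges_eq_Sigma fst_image_Sigma)

theorem theorem3p3:
  fixes n :: nat
  shows "tutte_poly (transfer_matroid n) = (\<Prod>k=1..n. varX - 1 + q_int k)"
proof -
  have fin: "finite (edges n)"
    by (simp add: edges_eq_Sigma)
  have "tutte_poly (transfer_matroid n) = (\<Sum>S\<in>Pow (edges n).
      (varX - 1) ^ (n - card (fst ` S)) * (varY - 1) ^ (card S - card (fst ` S)))"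
    by (auto simp: transfer_matroid_def MGS_eq rank_inj_on[OF fin] fst_edges intro!: sum.cong)
  \<comment> \<open>With \<open>v = varY - 1\<close> the base \<open>1 + v\<close> is
    \<open>varY\<close>, and the block over \<open>i\<close> has \<open>n - i\<close> edges.\<close>
  also have "\<dots> = (\<Prod>i<n. varX - 1 + q_int (n - i))"
    using sum_Pow_Sigma_corank_nullity[of "{..<n}" "\<lambda>i. {i<..n}" "varX - 1" "varY - 1"]
    by (simp add: edges_eq_Sigma q_int_def)
  also have "\<dots> = (\<Prod>k=1..n. varX - 1 + q_int k)"
    by (rule prod.reindex_bij_witness[of _ "\<lambda>k. n - k" "\<lambda>i. n - i"]) auto
  finally show ?thesis .
qed

end
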